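(* Let $\mathcal{H}$ be a complex Hilbert space and let $A\in\mathcal{B}(\mathcal{H})$. Then for any $0\le t\le 1$, \[\omega(A)=\sup_{\theta\in\mathbb{R}}\left\{\frac{\omega_r\left(e^{\mathrm{i}\theta}A\right)}{2R}\right\},\] where $r=\min\{t,1-t\}$ and $R=\max\{t,1-t\}$.
   Context: $\mathcal{B}(\mathcal{H})$ is the $C^*$-algebra of bounded linear operators on the complex Hilbert space $\mathcal{H}$. The numerical radius is $\omega(A)=\sup_{\|x\|=1}|\langle Ax,x\rangle|$. For $0\le s\le 1$, the $s$-weighted numerical radius of $A$ is $\omega_s(A)=\omega\left((1-2s)A^*+A\right)$. *)

theory Defs
  imports "HOL-Analysis.Analysis"
begin

class complex_vector = real_vector +
  fixes scaleC :: "complex \<Rightarrow> 'a \<Rightarrow> 'a" (infixr \<open>*\<^sub>C\<close> 75)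
  assumes scaleC_add_right: "a *\<^sub>C (x + y) = a *\<^sub>C x + a *\<^sub>C y"
    and scaleC_add_left: "(a + b) *\<^sub>C x = a *\<^sub>C x + b *\<^sub>C x"
    and scaleC_scaleC: "a *\<^sub>C b *\<^sub>C x = (a * b) *\<^sub>C x"
    and scaleC_one: "1 *\<^sub>C x = x"
    and scaleR_scaleC: "r *\<^sub>R x = complex_of_real r *\<^sub>C x"

text \<open>The inner product is linear in the first and antilinear in the second argument.\<close>

class complex_inner = complex_vector + real_normed_vector +
  fixes cinner :: "'a \<Rightarrow> 'a \<Rightarrow> complex"
  assumes cinner_add_left: "cinner (x + y) z = cinner x z + cinner y z"
    and cinner_scaleC_left: "cinner (c *\<^sub>C x) y = c * cinner x y"
    and cinner_commute: "cinner x y = cnj (cinner y x)"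
    and cinner_ge_zero: "0 \<le> Re (cinner x x)"
    and cinner_eq_zero_iff: "cinner x x = 0 \<longleftrightarrow> x = 0"
    and norm_eq_sqrt_cinner: "norm x = sqrt (Re (cinner x x))"

class complex_hilbert_space = complex_inner + complete_space

instantiation complex :: complex_hilbert_space
begin

definition scaleC_complex :: "complex \<Rightarrow> complex \<Rightarrow> complex"
  where "scaleC_complex c x = c * x"

definition cinner_complex :: "complex \<Rightarrow> complex \<Rightarrow> complex"
  where "cinner_complex x y = x * cnj y"

instance
  by standard
    (auto simp: scaleC_complex_def cinner_complex_def algebra_simps scaleR_conv_of_real
      cmod_def power2_eq_square)

end

definition bounded_clinear :: "('a::complex_inner \<Rightarrow> 'a) \<Rightarrow> bool"
  where "bounded_clinear A \<longleftrightarrow> bounded_linear A \<and> (\<forall>c x. A (c *\<^sub>C x) = c *\<^sub>C A x)"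

text \<open>On a Hilbert space the described operator exists and is unique if
  \<^term>\<open>bounded_clinear A\<close>; nothing is claimed about other \<^term>\<open>A\<close>.\<close>

definition cadjoint :: "('a::complex_hilbert_space \<Rightarrow> 'a) \<Rightarrow> 'a \<Rightarrow> 'a"
  where "cadjoint A = (THE B. bounded_clinear B \<and> (\<forall>x y. cinner (A x) y = cinner x (B y)))"

text \<open>The supremum is that of a subset of $[0,\infty)$. Inserting \<open>0\<close> only matters on the zero space,
  which has no unit vectors and where \<^term>\<open>Sup {} :: real\<close> would be unspecified: the numerical
  radius is \<open>0\<close> there.\<close>

definition numerical_radius :: "('a::complex_inner \<Rightarrow> 'a) \<Rightarrow> real"
  where "numerical_radius A = Sup (insert 0 {cmod (cinner (A x) x) | x. norm x = 1})"

definition weighted_numerical_radius :: "real \<Rightarrow> ('a::complex_hilbert_space \<Rightarrow> 'a) \<Rightarrow> real"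
  where "weighted_numerical_radius s A =
    numerical_radius (\<lambda>x. complex_of_real (1 - 2 * s) *\<^sub>C cadjoint A x + A x)"

end

theory Submission
  imports Defs
begin

text \<open>Write \<open>s = 1 - 2 r\<close>, so that \<open>0 \<le> s \<le> 1\<close> and \<open>2 R = 1 + s\<close>. For a unit vector \<open>x\<close> put
  \<open>z = \<langle>A x, x\<rangle>\<close> and \<open>w = e\<^sup>i\<^sup>\<theta> z\<close>; the quadratic form of the weighted operator at \<open>x\<close> is
  \<open>s cnj w + w\<close>, whose modulus is at most \<open>(1 + s) \<bar>z\<bar>\<close>, with equality when \<open>\<theta>\<close> rotates \<open>z\<close> onto
  the nonnegative real axis. The existence of the adjoint rests on the Riesz representation theorem,
  obtained by minimising \<open>\<parallel>x\<parallel>\<^sup>2 - 2 \<phi> x\<close>: minimising sequences are Cauchy by the parallelogram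
  law.\<close>

section \<open>Inner product calculus and the Cauchy-Schwarz inequality\<close>

lemma cinner_add_right: "cinner x (y + z) = cinner x y + cinner x (z::'a::complex_inner)"
  by (metis cinner_add_left cinner_commute complex_cnj_add)

lemma cinner_scaleC_right: "cinner x (c *\<^sub>C y) = cnj c * cinner x (y::'a::complex_inner)"
  by (metis cinner_commute cinner_scaleC_left complex_cnj_mult)

lemma cinner_scaleR_left: "cinner (r *\<^sub>R x) y = of_real r * cinner x (y::'a::complex_inner)"
  by (simp add: scaleR_scaleC cinner_scaleC_left)

lemma cinner_scaleR_right: "cinner x (r *\<^sub>R y) = of_real r * cinner x (y::'a::complex_inner)"
  by (simp add: scaleR_scaleC cinner_scaleC_right)

lemma cinner_diff_left: "cinner (x - y) z = cinner x z - cinner y (z::'a::complex_inner)"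
  using cinner_add_left[of "x - y" y z] by simp

lemma cinner_diff_right: "cinner x (y - z) = cinner x y - cinner x (z::'a::complex_inner)"
  using cinner_add_right[of x "y - z" z] by simp

lemma Re_cinner_commute: "Re (cinner x y) = Re (cinner y (x::'a::complex_inner))"
  by (subst cinner_commute) simp

lemma Re_cinner_self: "Re (cinner x x) = (norm (x::'a::complex_inner))\<^sup>2"
  by (simp add: norm_eq_sqrt_cinner cinner_ge_zero)

lemma cinner_self: "cinner x x = complex_of_real ((norm (x::'a::complex_inner))\<^sup>2)"
proof -
  have "Im (cinner x x) = 0"
    using arg_cong[OF cinner_commute[of x x], of Im] by simp
  then show ?thesis
    by (simp add: complex_eq_iff Re_cinner_self)
qed

lemma norm_add_sq:
  "(norm (x + y))\<^sup>2 = (norm x)\<^sup>2 + 2 * Re (cinner x y) + (norm (y::'a::complex_inner))\<^sup>2"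
  by (simp add: Re_cinner_self[symmetric] cinner_add_left cinner_add_right
      Re_cinner_commute[of y x])

lemma parallelogram_law:
  "(norm (x + y))\<^sup>2 + (norm (x - y))\<^sup>2 = 2 * (norm x)\<^sup>2 + 2 * (norm (y::'a::complex_inner))\<^sup>2"
  by (simp add: Re_cinner_self[symmetric] cinner_add_left cinner_add_right
      cinner_diff_left cinner_diff_right)

text \<open>Squaring the triangle inequality and expanding the left side leaves exactly this. The
  class already supplies the triangle inequality, so the usual order of derivation is
  reversed.\<close>

lemma Re_cinner_le_norm: "Re (cinner x y) \<le> norm x * norm (y::'a::complex_inner)"
proof -
  have "(norm (x + y))\<^sup>2 \<le> (norm x + norm y)\<^sup>2"
    by (intro power_mono norm_triangle_ineq) auto
  then show ?thesis
    by (simp add: norm_add_sq power2_sum)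
qed

text \<open>Serves twice: to pass from real parts to moduli in Cauchy-Schwarz, and to choose the
  optimal angle in the theorem. At \<open>z = 0\<close> both sides vanish.\<close>

lemma rotate_to_norm: "exp (\<i> * complex_of_real (- Arg z)) * z = complex_of_real (cmod z)"
proof -
  have "exp (\<i> * complex_of_real (- Arg z)) * (of_real (cmod z) * cis (Arg z))
      = of_real (cmod z)"
    by (simp add: cis_conv_exp exp_minus)
  then show ?thesis
    by (metis rcis_cmod_Arg rcis_def)
qed

text \<open>A unimodular factor \<open>c\<close> on \<open>x\<close> makes the inner product real
  and nonnegative without changing the norm of \<open>x\<close>, so the bound on real parts
  suffices.\<close>

lemma cmod_cinner_le_norm: "cmod (cinner x y) \<le> norm x * norm (y::'a::complex_inner)"
proof -
  define c where "c = exp (\<i> * complex_of_real (- Arg (cinner x y)))"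
  have c: "c * cnj c = 1"
    by (simp add: c_def complex_norm_square[symmetric])
  have "cinner (c *\<^sub>C x) (c *\<^sub>C x) = (c * cnj c) * cinner x x"
    by (simp add: cinner_scaleC_left cinner_scaleC_right)
  then have "norm (c *\<^sub>C x) = norm x"
    by (simp add: c norm_eq_sqrt_cinner)
  moreover have "cmod (cinner x y) = Re (cinner (c *\<^sub>C x) y)"
    by (simp only: c_def cinner_scaleC_left rotate_to_norm Re_complex_of_real)
  ultimately show ?thesis
    using Re_cinner_le_norm[of "c *\<^sub>C x" y] by simp
qed

lemma cinner_ext:
  assumes "\<And>x. cinner x y = cinner x (z::'a::complex_inner)"
  shows "y = z"
proof -
  have "cinner (y - z) (y - z) = 0"
    by (simp only: cinner_diff_right assms diff_self)
  then show ?thesis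
    by (simp add: cinner_eq_zero_iff)
qed

section \<open>Riesz representation and adjoints\<close>

lemma real_riesz_representation:
  fixes \<phi> :: "'a::complex_hilbert_space \<Rightarrow> real"
  assumes "bounded_linear \<phi>"
  obtains w where "\<And>x. \<phi> x = Re (cinner x w)"
proof -
  interpret \<phi>: bounded_linear \<phi> by fact
  define g where "g x = (norm x)\<^sup>2 - 2 * \<phi> x" for x
  define m where "m = Inf (range g)"
  obtain K where K: "\<And>x. \<bar>\<phi> x\<bar> \<le> norm x * K"
    using \<phi>.bounded by auto
  have "- K\<^sup>2 \<le> g x" for x
  proof -
    have "0 \<le> (norm x - K)\<^sup>2" by simp
    also have "\<dots> = (norm x)\<^sup>2 - 2 * (norm x * K) + K\<^sup>2"
      by (simp add: power2_diff)
    finally show ?thesis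
      using K[of x] by (simp add: g_def)
  qed
  then have bdd: "bdd_below (range g)"
    by (auto simp: bdd_below_def)
  have m_le: "m \<le> g x" for x
    unfolding m_def by (rule cInf_lower[OF _ bdd]) simp
  have "\<exists>x. g x < m + 1 / real (Suc n)" for n
    using cInf_lessD[of "range g" "m + 1 / real (Suc n)"] by (auto simp: m_def)
  then obtain X where X: "\<And>n. g (X n) < m + 1 / real (Suc n)"
    by metis
  \<comment> \<open>The midpoint of \<open>x\<close> and \<open>y\<close> cannot take
    \<open>g\<close> below \<open>m\<close>; by the parallelogram law, two near-minimisers are
    therefore close to each other.\<close>
  have dist_le: "(norm (x - y))\<^sup>2 \<le> 2 * (g x + g y - 2 * m)" for x y
  proof -
    have "4 * g ((1/2) *\<^sub>R (x + y)) = (norm (x + y))\<^sup>2 - 4 * (\<phi> x + \<phi> y)"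
      by (simp add: g_def \<phi>.scaleR \<phi>.add power_divide algebra_simps del: scaleR_add_right)
    then show ?thesis
      using m_le[of "(1/2) *\<^sub>R (x + y)"] parallelogram_law[of x y] by (simp add: g_def)
  qed
  have "Cauchy X"
  proof (rule metric_CauchyI)
    fix e :: real
    assume e: "0 < e"
    then obtain N where N: "inverse (real (Suc N)) < e\<^sup>2 / 8"
      using reals_Archimedean[of "e\<^sup>2 / 8"] by auto
    \<comment> \<open>With both values of \<open>g\<close> within \<open>e^2 / 8\<close> of
      \<open>m\<close>, \<open>dist_le\<close> bounds the squared distance by
      \<open>e^2 / 2\<close>.\<close>
    have small: "g (X n) < m + e\<^sup>2 / 8" if "N \<le> n" for n
    proof -
      have "1 / real (Suc n) \<le> inverse (real (Suc N))"
        using that by (simp add: field_simps)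
      then show ?thesis
        using X[of n] N by linarith
    qed
    have "dist (X i) (X j) < e" if "N \<le> i" "N \<le> j" for i j
    proof -
      have "(norm (X i - X j))\<^sup>2 < e\<^sup>2"
        using dist_le[of "X i" "X j"] small[OF that(1)] small[OF that(2)]
          zero_less_power[OF e, of 2] by argo
      then show ?thesis
        using e by (simp add: dist_norm power_less_imp_less_base)
    qed
    then show "\<exists>M. \<forall>i\<ge>M. \<forall>j\<ge>M. dist (X i) (X j) < e"
      by blast
  qed
  then obtain w where w: "X \<longlonglongrightarrow> w"
    using Cauchy_convergent convergent_def by blast
  have "(\<lambda>n. g (X n)) \<longlonglongrightarrow> g w"
    unfolding g_def by (intro tendsto_intros w \<phi>.tendsto)
  moreover have "(\<lambda>n. m + 1 / real (Suc n)) \<longlonglongrightarrow> m + 0"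
    using LIMSEQ_inverse_real_of_nat by (intro tendsto_intros) (simp add: divide_inverse)
  ultimately have "g w \<le> m + 0"
    by (rule LIMSEQ_le) (use X less_imp_le in blast)
  then have min: "g w \<le> g x" for x
    using m_le[of x] by simp
  have "\<phi> h \<le> Re (cinner h w)" for h
  proof (rule ccontr)
    assume "\<not> ?thesis"
    then have d: "\<phi> h - Re (cinner h w) > 0" (is "?d > 0") by simp
    \<comment> \<open>First variation at the minimiser: moving from \<open>w\<close> to
      \<open>w + e *\<^sub>R h\<close> changes \<open>g\<close> by a term linear in \<open>e\<close>
      and a quadratic one. For small positive \<open>e\<close> the linear one would win and make
      \<open>g\<close> drop.\<close>
    have var: "2 * e * ?d \<le> e\<^sup>2 * (norm h)\<^sup>2" for e :: real
      using min[of "w + e *\<^sub>R h"]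
      by (simp add: g_def norm_add_sq \<phi>.add \<phi>.scaleR cinner_scaleR_right
          Re_cinner_commute[of w h] power_mult_distrib algebra_simps)
    \<comment> \<open>Small enough that \<open>e * (norm h)^2\<close> is at most the gap, while
      \<open>var\<close> would force it to be at least twice the gap. The \<open>+ 1\<close> keeps
      the denominator positive when \<open>h = 0\<close>.\<close>
    define e where "e = ?d / ((norm h)\<^sup>2 + 1)"
    have "e > 0"
      using d by (simp add: e_def add_nonneg_pos)
    then have "2 * ?d \<le> e * (norm h)\<^sup>2"
      using var[of e] by (simp add: power2_eq_square)
    also have "\<dots> \<le> e * ((norm h)\<^sup>2 + 1)"
      using \<open>e > 0\<close> by simp
    also have "\<dots> = ?d"
      by (simp add: e_def add_nonneg_eq_0_iff)
    finally show False
      using d by simp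
  qed
  note le = this
  have "\<phi> x = Re (cinner x w)" for x
    \<comment> \<open>The reverse inequality is the one just proved, taken at \<open>- x\<close>;
      the two \<open>cinner_diff_left\<close> instances pull the sign out of the inner
      product.\<close>
    using le[of x] le[of "- x"] cinner_diff_left[of 0 x w] cinner_diff_left[of 0 0 w]
    by (simp add: \<phi>.neg)
  then show thesis ..
qed

lemma bounded_clinear_Re_cinner:
  fixes A :: "'a::complex_inner \<Rightarrow> 'a"
  assumes "bounded_clinear A"
  shows "bounded_linear (\<lambda>x. Re (cinner (A x) y))"
proof -
  interpret A: bounded_linear A
    using assms by (simp add: bounded_clinear_def)
  obtain K where K: "\<And>x. norm (A x) \<le> norm x * K"
    using A.bounded by auto
  show ?thesis
  proof (rule bounded_linear_intro)
    fix x
    have "\<bar>Re (cinner (A x) y)\<bar> \<le> norm (A x) * norm y"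
      by (rule order_trans[OF abs_Re_le_cmod cmod_cinner_le_norm])
    also have "\<dots> \<le> norm x * (K * norm y)"
      using mult_right_mono[OF K[of x], of "norm y"] by (simp add: mult.assoc)
    finally show "norm (Re (cinner (A x) y)) \<le> norm x * (K * norm y)"
      by simp
  qed (simp_all add: A.add A.scaleR cinner_add_left cinner_scaleR_left)
qed

text \<open>Riesz applied to the real part of \<open>cinner (A x) y\<close> yields
  \<open>B y\<close>. Replacing \<open>x\<close> by \<open>\<i> *\<^sub>C x\<close> recovers the
  imaginary parts, and nondegeneracy of the inner product makes \<open>B\<close> complex
  linear.\<close>

lemma adjoint_exists:
  fixes A :: "'a::complex_hilbert_space \<Rightarrow> 'a"
  assumes A: "bounded_clinear A"
  shows "\<exists>B. bounded_clinear B \<and> (\<forall>x y. cinner (A x) y = cinner x (B y))"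
proof -
  interpret A: bounded_linear A
    using A by (simp add: bounded_clinear_def)
  have AC: "A (c *\<^sub>C x) = c *\<^sub>C A x" for c x
    using A by (simp add: bounded_clinear_def)
  have "\<exists>w. \<forall>x. Re (cinner (A x) y) = Re (cinner x w)" for y
    using real_riesz_representation[OF bounded_clinear_Re_cinner[OF A, of y]] by blast
  then obtain B where ReB: "\<And>x y. Re (cinner (A x) y) = Re (cinner x (B y))"
    by metis
  have B: "cinner (A x) y = cinner x (B y)" for x y
    using ReB[of x y] ReB[of "\<i> *\<^sub>C x" y]
    by (simp add: AC cinner_scaleC_left complex_eq_iff)
  have add: "B (x + y) = B x + B y" for x y
    by (rule cinner_ext) (simp add: B[symmetric] cinner_add_right)
  have scale: "B (c *\<^sub>C x) = c *\<^sub>C B x" for c x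
    by (rule cinner_ext) (simp add: B[symmetric] cinner_scaleC_right)
  obtain K where K: "K > 0" "\<And>x. norm (A x) \<le> norm x * K"
    using A.pos_bounded by auto
  have bound: "norm (B y) \<le> norm y * K" for y
  proof (cases "B y = 0")
    case True
    then show ?thesis using K(1) by simp
  next
    case False
    \<comment> \<open>Testing the adjoint identity at \<open>x = B y\<close> and cancelling one
      factor \<open>norm (B y)\<close> gives \<open>B\<close> the same bound \<open>K\<close> as
      \<open>A\<close>.\<close>
    have "norm (B y) * norm (B y) = Re (cinner (A (B y)) y)"
      by (simp add: B Re_cinner_self power2_eq_square)
    also have "\<dots> \<le> norm (A (B y)) * norm y"
      by (rule Re_cinner_le_norm)
    also have "\<dots> \<le> norm (B y) * K * norm y"
      by (intro mult_right_mono K(2)) simp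
    finally show ?thesis
      using False by (simp add: mult.assoc mult.commute[of K])
  qed
  have "bounded_linear B"
    by (rule bounded_linear_intro[OF add _ bound]) (simp add: scaleR_scaleC scale)
  then have "bounded_clinear B"
    unfolding bounded_clinear_def using scale by blast
  then show ?thesis
    using B by blast
qed

text \<open>Existence together with uniqueness, which comes from \<open>cinner_ext\<close>, gives
  the definite description in \<open>cadjoint\<close> its meaning.\<close>

lemma cinner_cadjoint:
  fixes A :: "'a::complex_hilbert_space \<Rightarrow> 'a"
  assumes "bounded_clinear A"
  shows "cinner (A x) y = cinner x (cadjoint A y)"
proof -
  have "\<exists>!B. bounded_clinear B \<and> (\<forall>x y. cinner (A x) y = cinner x (B y))"
  proof (rule ex_ex1I[OF adjoint_exists[OF assms]])
    fix B C
    assume "bounded_clinear B \<and> (\<forall>x y. cinner (A x) y = cinner x (B y))"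
      and "bounded_clinear C \<and> (\<forall>x y. cinner (A x) y = cinner x (C y))"
    then have "cinner x (B y) = cinner x (C y)" for x y
      by metis
    then have "B x = C x" for x
      by (rule cinner_ext)
    then show "B = C" ..
  qed
  from theI'[OF this] show ?thesis
    unfolding cadjoint_def[symmetric] by blast
qed

lemma cinner_cadjoint_self:
  fixes A :: "'a::complex_hilbert_space \<Rightarrow> 'a"
  assumes "bounded_clinear A"
  shows "cinner (cadjoint A x) x = cnj (cinner (A x) x)"
  using cinner_cadjoint[OF assms, of x x] cinner_commute[of "cadjoint A x" x] by simp

text \<open>Needed because the theorem takes the adjoint of the rotated operator, and
  \<open>cadjoint\<close> is specified only for bounded complex linear maps.\<close>

lemma bounded_clinear_scaleC:
  fixes A :: "'a::complex_inner \<Rightarrow> 'a"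
  assumes "bounded_clinear A"
  shows "bounded_clinear (\<lambda>x. c *\<^sub>C A x)"
proof -
  interpret A: bounded_linear A
    using assms by (simp add: bounded_clinear_def)
  have AC: "A (d *\<^sub>C x) = d *\<^sub>C A x" for d x
    using assms by (simp add: bounded_clinear_def)
  obtain K where K: "\<And>x. norm (A x) \<le> norm x * K"
    using A.bounded by auto
  have norm_scaleC: "norm (c *\<^sub>C x) = cmod c * norm x" for x :: 'a
  proof -
    have "cinner (c *\<^sub>C x) (c *\<^sub>C x) = (c * cnj c) * cinner x x"
      by (simp add: cinner_scaleC_left cinner_scaleC_right)
    also have "\<dots> = complex_of_real ((cmod c * norm x)\<^sup>2)"
      by (simp only: complex_norm_square[symmetric] cinner_self of_real_mult power_mult_distrib)
    finally have "cinner (c *\<^sub>C x) (c *\<^sub>C x) = complex_of_real ((cmod c * norm x)\<^sup>2)" .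
    then show ?thesis
      by (simp add: norm_eq_sqrt_cinner[of "c *\<^sub>C x"])
  qed
  have "bounded_linear (\<lambda>x. c *\<^sub>C A x)"
  proof (rule bounded_linear_intro)
    fix x
    show "norm (c *\<^sub>C A x) \<le> norm x * (cmod c * K)"
      using mult_left_mono[OF K[of x], of "cmod c"] by (simp add: norm_scaleC mult.left_commute)
  qed (simp_all add: A.add AC scaleR_scaleC scaleC_add_right scaleC_scaleC mult.commute)
  then show ?thesis
    by (simp add: bounded_clinear_def AC scaleC_scaleC mult.commute)
qed

section \<open>Bounds on the numerical radius\<close>

lemma numerical_radius_least:
  assumes "0 \<le> M" and "\<And>x. norm x = 1 \<Longrightarrow> cmod (cinner (A x) x) \<le> M"
  shows "numerical_radius A \<le> M"
  unfolding numerical_radius_def by (rule cSup_least) (use assms in auto)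

text \<open>\<open>Sup\<close> on the reals is known to be an upper bound only for sets bounded
  above; any common bound \<open>M\<close> provides this.\<close>

lemma numerical_radius_upper:
  assumes "\<And>x. norm x = 1 \<Longrightarrow> cmod (cinner (A x) x) \<le> M"
  shows "norm x = 1 \<Longrightarrow> cmod (cinner (A x) x) \<le> numerical_radius A"
    and "0 \<le> numerical_radius A"
proof -
  have bdd: "bdd_above (insert 0 {cmod (cinner (A x) x) | x. norm x = 1})"
    using assms by (auto intro!: bdd_aboveI[of _ M])
  show "norm x = 1 \<Longrightarrow> cmod (cinner (A x) x) \<le> numerical_radius A"
    unfolding numerical_radius_def by (rule cSup_upper[OF _ bdd]) auto
  show "0 \<le> numerical_radius A"
    unfolding numerical_radius_def by (rule cSup_upper[OF _ bdd]) simp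
qed

lemma bounded_clinear_numerical_range:
  fixes A :: "'a::complex_inner \<Rightarrow> 'a"
  assumes "bounded_clinear A"
  obtains M where "\<And>x. norm x = 1 \<Longrightarrow> cmod (cinner (A x) x) \<le> M"
proof -
  obtain K where K: "\<And>x. norm (A x) \<le> norm x * K"
    using assms bounded_linear.bounded by (fastforce simp: bounded_clinear_def)
  have "cmod (cinner (A x) x) \<le> K" if "norm x = 1" for x
    using cmod_cinner_le_norm[of "A x" x] K[of x] that by simp
  then show thesis ..
qed

theorem theorem2p2:
  fixes A :: "'a::complex_hilbert_space \<Rightarrow> 'a" and t :: real
  assumes "bounded_clinear A" and "0 \<le> t" and "t \<le> 1"
  shows "numerical_radius A =
    (SUP \<theta>::real. weighted_numerical_radius (min t (1 - t))
        (\<lambda>x. exp (\<i> * complex_of_real \<theta>) *\<^sub>C A x) / (2 * max t (1 - t)))"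
proof -
  define s where "s = 1 - 2 * min t (1 - t)"
  have s: "0 \<le> s" "2 * max t (1 - t) = 1 + s"
    by (auto simp: s_def min_def max_def)
  define rot where "rot \<theta> = exp (\<i> * complex_of_real \<theta>)" for \<theta>
  \<comment> \<open>Rotation and adjoint stay unsimplified here, so that the weighted numerical
    radius of the rotated operator is recovered at the end by unfolding alone.\<close>
  define T where "T \<theta> x = complex_of_real s *\<^sub>C cadjoint (\<lambda>x. rot \<theta> *\<^sub>C A x) x + rot \<theta> *\<^sub>C A x"
    for \<theta> x
  obtain M where M: "\<And>x. norm x = 1 \<Longrightarrow> cmod (cinner (A x) x) \<le> M"
    using bounded_clinear_numerical_range[OF assms(1)] by blast
  note \<omega> = numerical_radius_upper[of A, OF M]
  have form: "cinner (T \<theta> x) x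
      = of_real s * cnj (rot \<theta> * cinner (A x) x) + rot \<theta> * cinner (A x) x" for \<theta> x
    unfolding T_def cinner_add_left cinner_scaleC_left
      cinner_cadjoint_self[OF bounded_clinear_scaleC[OF assms(1)]] ..
  have T_le: "cmod (cinner (T \<theta> x) x) \<le> (1 + s) * numerical_radius A" if "norm x = 1" for \<theta> x
  proof -
    have "cmod (cinner (T \<theta> x) x) \<le> s * cmod (cinner (A x) x) + cmod (cinner (A x) x)"
      unfolding form using s(1)
      by (intro order_trans[OF norm_triangle_ineq]) (simp add: norm_mult rot_def)
    also have "\<dots> = (1 + s) * cmod (cinner (A x) x)"
      by (simp add: algebra_simps)
    also have "\<dots> \<le> (1 + s) * numerical_radius A"
      using \<omega>(1)[OF _ that] s(1) by (intro mult_left_mono) auto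
    finally show ?thesis .
  qed
  have upper: "numerical_radius (T \<theta>) / (1 + s) \<le> numerical_radius A" for \<theta>
    using numerical_radius_least[OF _ T_le] \<omega>(2) s(1) by (simp add: field_simps)
  have bdd: "bdd_above (range (\<lambda>\<theta>. numerical_radius (T \<theta>) / (1 + s)))"
    using upper by (auto intro!: bdd_aboveI[of _ "numerical_radius A"])
  have "numerical_radius A = (SUP \<theta>. numerical_radius (T \<theta>) / (1 + s))"
  proof (rule antisym)
    show "numerical_radius A \<le> (SUP \<theta>. numerical_radius (T \<theta>) / (1 + s))"
    proof (rule numerical_radius_least)
      \<comment> \<open>The inserted \<open>0\<close> in the numerical radius must also lie below
        the supremum; any single angle shows this, here \<theta> = 0.\<close>
      have "0 \<le> numerical_radius (T 0) / (1 + s)"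
        using numerical_radius_upper(2)[OF T_le] s(1) by simp
      also have "\<dots> \<le> (SUP \<theta>. numerical_radius (T \<theta>) / (1 + s))"
        by (rule cSUP_upper[OF _ bdd]) simp
      finally show "0 \<le> (SUP \<theta>. numerical_radius (T \<theta>) / (1 + s))" .
    next
      fix x :: 'a
      assume x: "norm x = 1"
      \<comment> \<open>The maximising angle \<open>- Arg z\<close> varies with \<open>x\<close>, so
        each unit vector is compared separately with the supremum over all angles.\<close>
      define z where "z = cinner (A x) x"
      have "cinner (T (- Arg z) x) x = of_real ((1 + s) * cmod z)"
        unfolding form rot_def z_def[symmetric] rotate_to_norm by (simp add: algebra_simps)
      then have "(1 + s) * cmod z = cmod (cinner (T (- Arg z) x) x)"
        using s(1) by (simp only: norm_of_real) simp
      also have "\<dots> \<le> numerical_radius (T (- Arg z))"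
        by (rule numerical_radius_upper(1)[OF T_le x])
      finally have "cmod z \<le> numerical_radius (T (- Arg z)) / (1 + s)"
        using s(1) by (simp add: field_simps)
      also have "\<dots> \<le> (SUP \<theta>. numerical_radius (T \<theta>) / (1 + s))"
        by (rule cSUP_upper[OF _ bdd]) simp
      finally show "cmod (cinner (A x) x) \<le> (SUP \<theta>. numerical_radius (T \<theta>) / (1 + s))"
        by (simp add: z_def)
    qed
    show "(SUP \<theta>. numerical_radius (T \<theta>) / (1 + s)) \<le> numerical_radius A"
      by (rule cSUP_least) (use upper in auto)
  qed
  then show ?thesis
    by (simp only: weighted_numerical_radius_def s(2) s_def[symmetric] T_def[abs_def] rot_def)
qed

end
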